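(* Let $X(0,1)$ be an r.i. space and let $F$ be a Young function. If $X(0,1)$ is sub-diagonal, then so is $F(X)$. If $X(0,1)$ is uniformly sub-diagonal and $F$ satisfies the $\Delta_2$ condition near infinity, then $F(X)$ is uniformly sub-diagonal.
   Context: All spaces consist of measurable functions on $(0,1)$ with Lebesgue measure. A Young function is a convex, left-continuous $A:[0,\infty]\to[0,\infty]$ with $A(0)=0$, not identically zero or infinity on $(0,\infty]$. $F$ satisfies the $\Delta_2$ condition near infinity if there are $C>0$ and $t_0\in(0,\infty)$ with $F(2t)\le CF(t)$ for all $t\ge t_0$; it is understood that $F$ is then finite-valued on $[0,\infty)$. An r.i. norm is a map $\rho$ from non-negative measurable functions to $[0,\infty]$ such that: (P1) $\rho(f+g)\le\rho(f)+\rho(g)$, $\rho(\lambda f)=\lambda\rho(f)$ for $\lambda\ge0$, and $\rho(f)=0$ implies $f=0$ a.e.; (P2) $f\le g$ a.e. implies $\rho(f)\le\rho(g)$; (P3) $f_k\nearrow f$ a.e. implies $\rho(f_k)\nearrow\rho(f)$; (P4) $\rho(\chi_E)<\infty$ if $|E|<\infty$; (P5) if $|E|<\infty$ there is $C_E>0$ with $\int_Ef\le C_E\rho(f)$; (P6) $\rho(f)=\rho(g)$ whenever $f$ and $g$ have the same non-increasing rearrangement. The r.i. space is $X=\{f:\|f\|_X:=\rho(|f|)<\infty\}$. $L^A$ is the set of $f$ with $\|f\|_{L^A}=\inf\{\lambda>0:\int_0^1A(|f|/\lambda)\le1\}<\infty$. $X\hookrightarrow Y$ means $\|f\|_Y\le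 C\|f\|_X$ for all $f\in X$ with some $C>0$. $X\overset{*}{\hookrightarrow}Y$ (almost-compact embedding) means that for every sequence $\{E_n\}$ of measurable sets with $\chi_{E_n}\to0$ a.e. one has $\lim_{n\to\infty}\sup_{\|f\|_X\le1}\|f\chi_{E_n}\|_Y=0$. $X$ is sub-diagonal if $X=\bigcup\{L^A:A\text{ Young},\ L^A\hookrightarrow X\}$, and uniformly sub-diagonal if $X=\bigcup\{L^A:A\text{ Young},\ L^A\overset{*}{\hookrightarrow}X\}$. $F(X)$ is the set of measurable $f$ with $\|f\|_{F(X)}=\inf\{\lambda>0:\|F(|f|/\lambda)\|_X\le1\}<\infty$, with this norm. *)

theory Defs
  imports "HOL-Analysis.Analysis"
begin

text \<open>
  Functions on the unit interval are total functions on \<^typ>\<open>real\<close> that are measurable with respect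
  to \<open>M01\<close>; their values outside \<open>(0,1)\<close> are irrelevant.  General measurable functions take values
  in \<^typ>\<open>ereal\<close>, non-negative ones in \<^typ>\<open>ennreal\<close>.
\<close>

abbreviation M01 :: "real measure" where
  "M01 \<equiv> lebesgue_on {0<..<1}"

text \<open>
  Convexity is spelled out because \<^typ>\<open>ennreal\<close> is not a real vector space.  At \<open>t = 0\<close> the filter
  \<^term>\<open>at_left t\<close> is trivial, so left-continuity is a condition on \<open>(0,\<infinity>]\<close> only.
\<close>

definition Young_function :: "(ennreal \<Rightarrow> ennreal) \<Rightarrow> bool" where
  "Young_function A \<longleftrightarrow>
     A 0 = 0 \<and>
     (\<forall>s t. \<forall>u\<ge>0. \<forall>v\<ge>0. u + v = (1::real) \<longrightarrow>
        A (ennreal u * s + ennreal v * t) \<le> ennreal u * A s + ennreal v * A t) \<and>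
     (\<forall>t. continuous (at_left t) A) \<and>
     (\<exists>t>0. A t \<noteq> 0) \<and>
     (\<exists>t>0. A t \<noteq> \<infinity>)"

definition Delta2_near_infinity :: "(ennreal \<Rightarrow> ennreal) \<Rightarrow> bool" where
  "Delta2_near_infinity F \<longleftrightarrow>
     (\<forall>t<\<infinity>. F t < \<infinity>) \<and>
     (\<exists>C>0. \<exists>t0>0. \<forall>t\<ge>ennreal t0. F (2 * t) \<le> ennreal C * F t)"

definition decreasing_rearrangement :: "(real \<Rightarrow> ennreal) \<Rightarrow> real \<Rightarrow> ennreal" where
  "decreasing_rearrangement f t = Inf {s. emeasure M01 {x \<in> space M01. s < f x} \<le> ennreal t}"

locale ri_norm =
  fixes \<rho> :: "(real \<Rightarrow> ennreal) \<Rightarrow> ennreal"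
  assumes triangle: "f \<in> borel_measurable M01 \<Longrightarrow> g \<in> borel_measurable M01 \<Longrightarrow>
      \<rho> (\<lambda>x. f x + g x) \<le> \<rho> f + \<rho> g"
    and homogeneous: "f \<in> borel_measurable M01 \<Longrightarrow> 0 \<le> c \<Longrightarrow>
      \<rho> (\<lambda>x. ennreal c * f x) = ennreal c * \<rho> f"
    and zero_imp_AE_zero: "f \<in> borel_measurable M01 \<Longrightarrow> \<rho> f = 0 \<Longrightarrow> AE x in M01. f x = 0"
    and lattice: "f \<in> borel_measurable M01 \<Longrightarrow> g \<in> borel_measurable M01 \<Longrightarrow>
      AE x in M01. f x \<le> g x \<Longrightarrow> \<rho> f \<le> \<rho> g"
    and Fatou: "(\<And>k. fs k \<in> borel_measurable M01) \<Longrightarrow> f \<in> borel_measurable M01 \<Longrightarrow>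
      AE x in M01. incseq (\<lambda>k. fs k x) \<and> (\<lambda>k. fs k x) \<longlonglongrightarrow> f x \<Longrightarrow>
      incseq (\<lambda>k. \<rho> (fs k)) \<and> (\<lambda>k. \<rho> (fs k)) \<longlonglongrightarrow> \<rho> f"
    and indicator_finite: "E \<in> sets M01 \<Longrightarrow> emeasure M01 E < \<infinity> \<Longrightarrow> \<rho> (indicator E) < \<infinity>"
    and local_integrability: "E \<in> sets M01 \<Longrightarrow> emeasure M01 E < \<infinity> \<Longrightarrow>
      \<exists>C>0. \<forall>f\<in>borel_measurable M01. (\<integral>\<^sup>+x\<in>E. f x \<partial>M01) \<le> ennreal C * \<rho> f"
    and rearrangement_invariant: "f \<in> borel_measurable M01 \<Longrightarrow> g \<in> borel_measurable M01 \<Longrightarrow>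
      (\<And>t. 0 < t \<Longrightarrow> t < 1 \<Longrightarrow> decreasing_rearrangement f t = decreasing_rearrangement g t) \<Longrightarrow>
      \<rho> f = \<rho> g"

text \<open>
  A space is represented by its functional \<open>\<rho>\<close> on non-negative functions: \<open>fnorm \<rho> f\<close> is
  \<open>\<rho>(|f|)\<close>, and \<open>fspace \<rho>\<close> is the set of measurable functions for which it is finite.
\<close>

definition fnorm :: "((real \<Rightarrow> ennreal) \<Rightarrow> ennreal) \<Rightarrow> (real \<Rightarrow> ereal) \<Rightarrow> ennreal" where
  "fnorm \<rho> f = \<rho> (\<lambda>x. e2ennreal \<bar>f x\<bar>)"

definition fspace :: "((real \<Rightarrow> ennreal) \<Rightarrow> ennreal) \<Rightarrow> (real \<Rightarrow> ereal) set" where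
  "fspace \<rho> = {f \<in> borel_measurable M01. fnorm \<rho> f < \<infinity>}"

text \<open>The functionals defining \<open>L\<^sup>A\<close> and \<open>F(X)\<close>; in \<^typ>\<open>ennreal\<close> the infimum of the empty set is \<open>\<infinity>\<close>.\<close>

definition Orlicz :: "(ennreal \<Rightarrow> ennreal) \<Rightarrow> (real \<Rightarrow> ennreal) \<Rightarrow> ennreal" where
  "Orlicz A g = Inf {ennreal l | l. 0 < l \<and> (\<integral>\<^sup>+x. A (g x / ennreal l) \<partial>M01) \<le> 1}"

definition Orlicz_compose ::
  "(ennreal \<Rightarrow> ennreal) \<Rightarrow> ((real \<Rightarrow> ennreal) \<Rightarrow> ennreal) \<Rightarrow> (real \<Rightarrow> ennreal) \<Rightarrow> ennreal" where
  "Orlicz_compose F \<rho> g = Inf {ennreal l | l. 0 < l \<and> \<rho> (\<lambda>x. F (g x / ennreal l)) \<le> 1}"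

definition embedded ::
  "((real \<Rightarrow> ennreal) \<Rightarrow> ennreal) \<Rightarrow> ((real \<Rightarrow> ennreal) \<Rightarrow> ennreal) \<Rightarrow> bool" where
  "embedded \<rho> \<sigma> \<longleftrightarrow> (\<exists>C>0. \<forall>f\<in>fspace \<rho>. fnorm \<sigma> f \<le> ennreal C * fnorm \<rho> f)"

definition almost_compactly_embedded ::
  "((real \<Rightarrow> ennreal) \<Rightarrow> ennreal) \<Rightarrow> ((real \<Rightarrow> ennreal) \<Rightarrow> ennreal) \<Rightarrow> bool" where
  "almost_compactly_embedded \<rho> \<sigma> \<longleftrightarrow>
     (\<forall>E :: nat \<Rightarrow> real set.
        (\<forall>n. E n \<in> sets M01) \<and> (AE x in M01. (\<lambda>n. indicator (E n) x :: real) \<longlonglongrightarrow> 0) \<longrightarrow>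
        (\<lambda>n. SUP f\<in>{f \<in> fspace \<rho>. fnorm \<rho> f \<le> 1}. fnorm \<sigma> (\<lambda>x. f x * indicator (E n) x))
          \<longlonglongrightarrow> 0)"

definition sub_diagonal :: "((real \<Rightarrow> ennreal) \<Rightarrow> ennreal) \<Rightarrow> bool" where
  "sub_diagonal \<rho> \<longleftrightarrow>
     fspace \<rho> = \<Union> {fspace (Orlicz A) | A. Young_function A \<and> embedded (Orlicz A) \<rho>}"

definition uniformly_sub_diagonal :: "((real \<Rightarrow> ennreal) \<Rightarrow> ennreal) \<Rightarrow> bool" where
  "uniformly_sub_diagonal \<rho> \<longleftrightarrow>
     fspace \<rho> = \<Union> {fspace (Orlicz A) | A. Young_function A \<and> almost_compactly_embedded (Orlicz A) \<rho>}"

end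

theory Submission
  imports Defs
begin

text \<open>
  Write \<open>Y = F(X)\<close> and, for a Young function \<open>A\<close>, put \<open>B = A \<circ> F\<close>, which is again a Young function.

  If \<open>f \<in> Y\<close>, then \<open>k = F(|f|/l)\<close> lies in \<open>X\<close> for some \<open>l\<close>, so the hypothesis on \<open>X\<close> gives a Young
  function \<open>A\<close> with \<open>k \<in> L\<^sup>A\<close> and \<open>L\<^sup>A\<close> embedded into \<open>X\<close>.  Since \<open>F(t/c) \<le> F(t)/c\<close> for
  \<open>c \<ge> 1\<close>, a constant can be moved inside \<open>F\<close>; this turns \<open>k \<in> L\<^sup>A\<close> into \<open>f \<in> L\<^sup>B\<close>
  (\<open>mem_Orlicz_composeE\<close>) and the embedding of \<open>L\<^sup>A\<close> into \<open>X\<close> into one of \<open>L\<^sup>B\<close> into \<open>Y\<close>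
  (\<open>embedded_compose\<close>).

  Almost-compactness (\<open>almost_compactly_embedded_compose\<close>) requires more: smallness of
  \<open>F(|g|/2)\<close> on the sets \<open>E\<^sub>n\<close>, uniform over the unit ball of \<open>L\<^sup>B\<close>, has to yield
  \<open>\<rho>(F(|g|/\<epsilon>) \<chi>\<^bsub>E n\<^esub>) \<le> 1\<close> for every \<open>\<epsilon> > 0\<close>, so a large constant has to be taken out of \<open>F\<close>.
  This is what the \<open>\<Delta>\<^sub>2\<close> condition allows, at the price of an additive constant
  (\<open>Delta2_iterate\<close>); that constant is harmless because \<open>\<rho>(\<chi>\<^bsub>E n\<^esub>) \<rightarrow> 0\<close>, as one sees by testing the
  almost-compact embedding of \<open>L\<^sup>A\<close> on a constant function.

  The two notions in the theorem are equalities of sets, so one also needs that an embedding implies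
  inclusion.  For an almost-compact embedding this holds because an element of \<open>L\<^sup>B\<close> is finite a.e.:
  cutting it at a high level leaves a bounded function and a remainder supported on a set
  whose indicator tends to \<open>0\<close> (\<open>almost_compactly_embedded_imp_subset\<close>).
\<close>

section \<open>Young functions\<close>

lemma Young_zero: "Young_function F \<Longrightarrow> F 0 = 0"
  by (simp add: Young_function_def)

lemma Young_convex:
  assumes "Young_function F" "0 \<le> u" "0 \<le> v" "u + v = (1::real)"
  shows "F (ennreal u * s + ennreal v * t) \<le> ennreal u * F s + ennreal v * F t"
  using assms unfolding Young_function_def by blast

lemma Young_scale:
  assumes "Young_function F" "0 \<le> u" "u \<le> 1"
  shows "F (ennreal u * t) \<le> ennreal u * F t"
  using Young_convex[OF assms(1,2), of "1 - u" t 0] assms by (simp add: Young_zero)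

lemma Young_tendsto_left:
  assumes "Young_function F"
  shows "(F \<longlongrightarrow> F t) (at_left t)"
  using assms by (simp add: Young_function_def continuous_within)

text \<open>
  Left-continuity makes a Young function lower semicontinuous.  This gives Borel measurability and
  the left-continuity of compositions.
\<close>

lemma Young_lower_semicontinuous:
  assumes "Young_function F" "a < F t"
  shows "\<exists>s<t. a < F s"
proof -
  have "0 < t"
    using assms by (metis Young_zero not_gr_zero not_less_zero)
  have "\<forall>\<^sub>F y in at_left t. a < F y"
    using order_tendstoD(1)[OF Young_tendsto_left[OF assms(1)] assms(2)] .
  then obtain b where "b < t" "\<And>y. b < y \<Longrightarrow> y < t \<Longrightarrow> a < F y"
    unfolding eventually_at_left[OF \<open>0 < t\<close>] by blast
  then show ?thesis
    by (meson dense)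
qed

text \<open>
  Below \<open>\<infinity>\<close> monotonicity comes from convexity, since \<open>s\<close> is a convex combination of \<open>0\<close> and \<open>t\<close>.
  Convexity says nothing about the value at \<open>\<infinity>\<close>, which is controlled by left-continuity.
\<close>

lemma Young_mono:
  assumes F: "Young_function F" and "s \<le> t"
  shows "F s \<le> F t"
proof -
  have fin: "F s \<le> F t" if st: "s \<le> t" "t < \<infinity>" for s t
  proof (cases "t = 0")
    case True
    then show ?thesis using st by simp
  next
    case False
    obtain b where b: "t = ennreal b" "0 \<le> b"
      using st by (cases t) auto
    with False have "0 < b" by auto
    obtain a where a: "s = ennreal a" "0 \<le> a"
      using st by (cases s) (auto simp: top_unique)
    have ab: "a \<le> b" using st a b by simp
    have "s = ennreal (a / b) * t"
      using a b \<open>0 < b\<close> by (simp flip: ennreal_mult)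
    then have "F s \<le> ennreal (a / b) * F t"
      using Young_scale[OF F, of "a / b" t] a ab \<open>0 < b\<close> by simp
    also have "\<dots> \<le> 1 * F t"
      using a ab \<open>0 < b\<close> by (intro mult_right_mono) (auto simp: ennreal_le_1)
    finally show ?thesis by simp
  qed
  show ?thesis
  proof (cases "t < \<infinity>")
    case True
    then show ?thesis using fin assms by blast
  next
    case False
    then have t: "t = \<infinity>" by (simp add: less_top[symmetric])
    show ?thesis
    proof (cases "s < \<infinity>")
      case False
      then show ?thesis using t by (simp add: less_top[symmetric])
    next
      case s: True
      show ?thesis
      proof (rule ccontr)
        assume "\<not> F s \<le> F t"
        then have "\<forall>\<^sub>F y in at_left t. F y < F s"
          using order_tendstoD(2)[OF Young_tendsto_left[OF F]] by force
        moreover have "s < t" using s t by simp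
        ultimately obtain b where b: "b < t" "\<And>y. b < y \<Longrightarrow> y < t \<Longrightarrow> F y < F s"
          unfolding eventually_at_left[OF \<open>s < t\<close>] by blast
        have "max b s < t" using b s t by simp
        then obtain y where y: "b < y" "s < y" "y < t" using dense[of "max b s" t] by auto
        then have "F s \<le> F y" using t by (intro fin) auto
        then show False using b(2)[OF y(1,3)] by (simp add: not_le[symmetric])
      qed
    qed
  qed
qed

text \<open>
  By left-continuity \<open>F\<close> is already positive at some finite point, and from there convexity
  forces at least linear growth.
\<close>

lemma Young_top:
  assumes F: "Young_function F"
  shows "F \<infinity> = \<infinity>"
proof -
  obtain t where "0 < F t"
    using F unfolding Young_function_def by (metis not_gr_zero)
  then obtain s where s: "s < t" "0 < F s"
    using Young_lower_semicontinuous[OF F] by blast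
  have "of_nat n * F s \<le> F \<infinity>" for n
  proof (cases "n = 0")
    case False
    have "F s = F (ennreal (1 / n) * (of_nat n * s))"
      using False by (simp add: ennreal_of_nat_eq_real_of_nat flip: mult.assoc ennreal_mult)
    also have "\<dots> \<le> ennreal (1 / n) * F (of_nat n * s)"
      using False by (intro Young_scale[OF F]) auto
    finally have "of_nat n * F s \<le> of_nat n * (ennreal (1 / n) * F (of_nat n * s))"
      by (intro mult_left_mono) auto
    also have "\<dots> = F (of_nat n * s)"
      using False by (simp add: ennreal_of_nat_eq_real_of_nat flip: mult.assoc ennreal_mult)
    also have "\<dots> \<le> F \<infinity>"
      by (intro Young_mono[OF F]) simp
    finally show ?thesis .
  qed simp
  then have "(SUP n. of_nat n) * F s \<le> F \<infinity>"
    by (subst SUP_mult_right_ennreal) (auto intro: SUP_least)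
  then show ?thesis
    using s by (simp add: ennreal_SUP_of_nat_eq_top ennreal_top_mult top_unique split: if_splits)
qed

lemma Young_small:
  assumes F: "Young_function F" and "0 < (e::real)"
  shows "\<exists>c>0. F (ennreal c) \<le> ennreal e"
proof -
  obtain t where t: "0 < t" "F t \<noteq> \<infinity>"
    using F unfolding Young_function_def by blast
  have "t \<noteq> \<infinity>" using t Young_top[OF F] by metis
  then obtain r where r: "t = ennreal r" "0 < r"
    using t by (cases t) auto
  obtain K where K: "F t = ennreal K" "0 \<le> K"
    using t by (cases "F t") auto
  define u where "u = min 1 (e / (K + 1))"
  have u: "0 < u" "u \<le> 1" "u * K \<le> e"
  proof -
    show "0 < u" "u \<le> 1" using assms K by (auto simp: u_def)
    have "u * K \<le> e / (K + 1) * (K + 1)"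
      using assms K by (intro mult_mono) (auto simp: u_def)
    then show "u * K \<le> e" using K by simp
  qed
  have "F (ennreal (u * r)) \<le> ennreal u * F t"
    using Young_scale[OF F, of u t] u r by (simp add: ennreal_mult)
  also have "\<dots> \<le> ennreal e"
    using u K by (simp add: ennreal_leI flip: ennreal_mult)
  finally show ?thesis
    using u r by (intro exI[of _ "u * r"]) auto
qed

lemma Young_measurable:
  assumes F: "Young_function F"
  shows "F \<in> borel_measurable borel"
proof (rule borel_measurableI_greater)
  fix a
  have "{t. a < F t} = (\<Union>s\<in>{s. a < F s}. {s<..})"
  proof (intro equalityI subsetI)
    fix t assume "t \<in> (\<Union>s\<in>{s. a < F s}. {s<..})"
    then obtain s where "a < F s" "s \<le> t" by auto
    then show "t \<in> {t. a < F t}"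
      using Young_mono[OF F] by (auto intro: less_le_trans)
  qed (use Young_lower_semicontinuous[OF F] in auto)
  moreover have "open (\<Union>s\<in>{s. a < F s}. {s<..})" by (intro open_UN ballI open_greaterThan)
  ultimately have "open {t. a < F t}" by metis
  then show "{t \<in> space borel. a < F t} \<in> sets borel" by simp
qed

lemma Young_compose:
  assumes A: "Young_function A" and F: "Young_function F"
  shows "Young_function (A \<circ> F)"
  unfolding Young_function_def
proof (intro conjI allI impI)
  show "(A \<circ> F) 0 = 0" using A F by (simp add: Young_zero)
next
  fix s t and u v :: real
  assume uv: "0 \<le> u" "0 \<le> v" "u + v = 1"
  have "A (F (ennreal u * s + ennreal v * t)) \<le> A (ennreal u * F s + ennreal v * F t)"
    by (intro Young_mono[OF A] Young_convex[OF F] uv)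
  also have "\<dots> \<le> ennreal u * A (F s) + ennreal v * A (F t)"
    by (intro Young_convex[OF A] uv)
  finally show "(A \<circ> F) (ennreal u * s + ennreal v * t)
      \<le> ennreal u * (A \<circ> F) s + ennreal v * (A \<circ> F) t" by simp
next
  fix t
  show "continuous (at_left t) (A \<circ> F)"
    unfolding continuous_within
  proof (rule order_tendstoI)
    fix a assume "a < (A \<circ> F) t"
    then obtain s where s: "s < F t" "a < A s"
      using Young_lower_semicontinuous[OF A] by auto
    then obtain r where r: "r < t" "s < F r"
      using Young_lower_semicontinuous[OF F] by blast
    have "a < A (F y)" if "r < y" for y
      using s r that Young_mono[OF A, of s "F y"] Young_mono[OF F, of r y] by force
    then show "\<forall>\<^sub>F y in at_left t. a < (A \<circ> F) y"
      unfolding eventually_at_left[OF r(1)] using r(1) by auto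
  next
    fix a assume "(A \<circ> F) t < a"
    then have "(A \<circ> F) y < a" if "y < t" for y
      using Young_mono[OF A Young_mono[OF F, of y t]] that by (auto intro: le_less_trans less_imp_le)
    then show "\<forall>\<^sub>F y in at_left t. (A \<circ> F) y < a"
      by (auto simp: eventually_at_filter)
  qed
next
  show "\<exists>t>0. (A \<circ> F) t \<noteq> 0"
    using Young_top[OF A] Young_top[OF F] by (intro exI[of _ \<infinity>]) auto
next
  obtain c where c: "0 < c" "A (ennreal c) \<le> ennreal 1"
    using Young_small[OF A, of 1] by auto
  obtain d where d: "0 < d" "F (ennreal d) \<le> ennreal c"
    using Young_small[OF F c(1)] by auto
  have "A (F (ennreal d)) \<le> 1"
    using Young_mono[OF A d(2)] c by simp
  then show "\<exists>t>0. (A \<circ> F) t \<noteq> \<infinity>"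
    using d by (intro exI[of _ "ennreal d"]) (auto simp: top_unique)
qed

text \<open>
  Doubling \<open>k\<close> times costs the factor \<open>C ^ k\<close> above the threshold \<open>t0\<close>; below it monotonicity
  bounds \<open>F\<close> by a constant, and adding this constant makes the estimate valid for all \<open>t\<close>.
\<close>

lemma Delta2_iterate:
  assumes F: "Young_function F" and "Delta2_near_infinity F"
  obtains C t0 :: real where "0 < C" "\<And>k t. F (2 ^ k * t) \<le> ennreal (C ^ k) * F t + F (2 ^ k * ennreal t0)"
proof -
  obtain C t0 where C: "0 < C"
    and D: "\<And>t. ennreal t0 \<le> t \<Longrightarrow> F (2 * t) \<le> ennreal C * F t"
    using assms(2) unfolding Delta2_near_infinity_def by blast
  have "F (2 ^ k * t) \<le> ennreal (C ^ k) * F t" if t: "ennreal t0 \<le> t" for k t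
  proof (induction k)
    case (Suc k)
    have "(1::ennreal) \<le> 2 ^ k" by (rule one_le_power) simp
    then have "1 * t \<le> 2 ^ k * t" by (intro mult_right_mono) auto
    then have "F (2 * (2 ^ k * t)) \<le> ennreal C * F (2 ^ k * t)"
      using t by (intro D) auto
    also have "\<dots> \<le> ennreal C * (ennreal (C ^ k) * F t)"
      using Suc by (intro mult_left_mono) auto
    finally show ?case
      using C by (simp add: ennreal_mult mult.assoc)
  qed simp
  moreover have "F (2 ^ k * t) \<le> F (2 ^ k * ennreal t0)" if "t \<le> ennreal t0" for k t
    using that by (intro Young_mono[OF F] mult_left_mono) auto
  ultimately have "F (2 ^ k * t) \<le> ennreal (C ^ k) * F t + F (2 ^ k * ennreal t0)" for k t
    by (metis add_increasing add_increasing2 linear zero_le)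
  then show ?thesis using C that by blast
qed

section \<open>Luxemburg functionals\<close>

text \<open>
  An Orlicz norm is the Luxemburg functional over the integral, so that facts about
  \<open>Orlicz_compose\<close> for an arbitrary functional serve both \<open>L\<^sup>A\<close> and \<open>F(X)\<close>.
\<close>

lemma Orlicz_eq: "Orlicz A = Orlicz_compose A (nn_integral M01)"
  by (intro ext) (simp add: Orlicz_def Orlicz_compose_def)

lemma divide_ennreal_mult:
  assumes "0 < l" "0 < c"
  shows "x / ennreal (l * c) = ennreal (1 / c) * (x / ennreal l)"
proof -
  have "inverse (ennreal (l * c)) = ennreal (1 / c) * inverse (ennreal l)"
    using assms by (simp add: inverse_ennreal divide_inverse mult.commute flip: ennreal_mult)
  then show ?thesis by (simp add: divide_ennreal_def mult_ac)
qed

lemma Young_divide: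
  assumes "Young_function F" "0 < l" "1 \<le> c"
  shows "F (x / ennreal (l * c)) \<le> ennreal (1 / c) * F (x / ennreal l)"
  using assms by (simp add: divide_ennreal_mult Young_scale)

lemma Young_divide_antimono:
  assumes F: "Young_function F" and "0 < l" "l \<le> m"
  shows "F (x / ennreal m) \<le> F (x / ennreal l)"
proof -
  have "inverse (ennreal m) \<le> inverse (ennreal l)"
    using assms by (simp add: inverse_ennreal ennreal_leI le_imp_inverse_le)
  then show ?thesis
    unfolding divide_ennreal_def by (intro Young_mono[OF F] mult_left_mono) auto
qed

lemma Young_divide_measurable:
  assumes "Young_function F" "g \<in> borel_measurable M"
  shows "(\<lambda>x. F (g x / l)) \<in> borel_measurable M"
  using assms by (auto intro: measurable_compose[OF _ Young_measurable])

lemma Orlicz_compose_le: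
  "0 < l \<Longrightarrow> \<rho> (\<lambda>x. F (g x / ennreal l)) \<le> 1 \<Longrightarrow> Orlicz_compose F \<rho> g \<le> ennreal l"
  unfolding Orlicz_compose_def by (rule Inf_lower) blast

lemma Orlicz_compose_less:
  assumes "Orlicz_compose F \<rho> g < a"
  obtains l where "0 < l" "ennreal l < a" "\<rho> (\<lambda>x. F (g x / ennreal l)) \<le> 1"
  using assms unfolding Orlicz_compose_def Inf_less_iff by blast

lemma Orlicz_compose_finite:
  "Orlicz_compose F \<rho> g < \<infinity> \<longleftrightarrow> (\<exists>l>0. \<rho> (\<lambda>x. F (g x / ennreal l)) \<le> 1)"
  by (metis Orlicz_compose_le Orlicz_compose_less ennreal_less_top infinity_ennreal_def le_less_trans)

lemma Orlicz_unit_ball: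
  assumes "(\<integral>\<^sup>+x. A (h x) \<partial>M01) \<le> 1"
  shows "Orlicz A h \<le> 1"
  using Orlicz_compose_le[of 1 "nn_integral M01" A h] assms
  by (simp add: Orlicz_eq divide_ennreal_def)

lemma fspace_iff:
  "f \<in> fspace \<rho> \<longleftrightarrow> f \<in> borel_measurable M01 \<and> fnorm \<rho> f < \<infinity>"
  by (simp add: fspace_def)

lemma fnorm_enn2ereal [simp]: "fnorm \<rho> (\<lambda>x. enn2ereal (h x)) = \<rho> h"
  by (simp add: fnorm_def)

lemma fnorm_indicator:
  "fnorm \<rho> (\<lambda>x. f x * indicator E x) = \<rho> (\<lambda>x. e2ennreal \<bar>f x\<bar> * indicator E x)"
  unfolding fnorm_def by (intro arg_cong[of _ _ \<rho>] ext)
    (simp add: indicator_def e2ennreal_neg)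

text \<open>
  The Luxemburg scale \<open>m\<close> of \<open>F(g/l)\<close> in \<open>L\<^sup>A\<close> is moved inside \<open>F\<close>, which convexity permits once
  \<open>m\<close> is replaced by \<open>max 1 m\<close>.
\<close>

lemma Orlicz_compose_mem:
  assumes A: "Young_function A" and F: "Young_function F" and l: "0 < l"
    and fin: "Orlicz A (\<lambda>x. F (g x / ennreal l)) < \<infinity>"
  shows "Orlicz (A \<circ> F) g < \<infinity>"
proof -
  obtain m where m: "0 < m" "(\<integral>\<^sup>+x. A (F (g x / ennreal l) / ennreal m) \<partial>M01) \<le> 1"
    using fin unfolding Orlicz_eq Orlicz_compose_finite by blast
  define c where "c = max 1 m"
  have c: "1 \<le> c" "m \<le> c" by (auto simp: c_def)
  have "(A \<circ> F) (g x / ennreal (l * c)) \<le> A (F (g x / ennreal l) / ennreal m)" for x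
  proof -
    have "F (g x / ennreal (l * c)) \<le> ennreal (1 / c) * F (g x / ennreal l)"
      by (rule Young_divide[OF F l c(1)])
    also have "\<dots> = F (g x / ennreal l) / ennreal c"
      using c by (simp add: divide_ennreal_def inverse_ennreal divide_inverse mult.commute)
    finally have "A (F (g x / ennreal (l * c))) \<le> A (F (g x / ennreal l) / ennreal c)"
      by (rule Young_mono[OF A])
    also have "\<dots> \<le> A (F (g x / ennreal l) / ennreal m)"
      by (rule Young_divide_antimono[OF A m(1) c(2)])
    finally show ?thesis by simp
  qed
  then have "(\<integral>\<^sup>+x. (A \<circ> F) (g x / ennreal (l * c)) \<partial>M01) \<le> 1"
    by (intro order_trans[OF nn_integral_mono m(2)])
  then show ?thesis
    using l c unfolding Orlicz_eq Orlicz_compose_finite by (intro exI[of _ "l * c"]) auto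
qed

lemma (in ri_norm) mono:
  assumes "f \<in> borel_measurable M01" "g \<in> borel_measurable M01" "\<And>x. x \<in> space M01 \<Longrightarrow> f x \<le> g x"
  shows "\<rho> f \<le> \<rho> g"
  using assms by (intro lattice) auto

lemma (in ri_norm) one_finite: "\<rho> (\<lambda>_. 1) < \<infinity>"
proof -
  have S: "{0<..<1} \<in> sets M01" by (simp add: sets_restrict_space_iff)
  have "emeasure M01 {0<..<1} < \<infinity>"
    by (simp add: emeasure_restrict_space)
  then have "\<rho> (indicator {0<..<1}) < \<infinity>"
    using indicator_finite[OF S] by simp
  moreover have "\<rho> (\<lambda>_. 1) \<le> \<rho> (indicator {0<..<1})"
    by (intro mono borel_measurable_indicator S) (auto simp: space_restrict_space)
  ultimately show ?thesis by (rule le_less_trans[rotated])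
qed

text \<open>Bounded functions belong to \<open>F(X)\<close>, because \<open>F(t) \<rightarrow> 0\<close> as \<open>t \<rightarrow> 0\<close> and \<open>\<rho>(1) < \<infinity>\<close>.\<close>

lemma (in ri_norm) Orlicz_compose_const_finite:
  assumes F: "Young_function F"
  shows "Orlicz_compose F \<rho> (\<lambda>_. of_nat n) < \<infinity>"
proof -
  obtain K where K: "\<rho> (\<lambda>_. 1) = ennreal K" "0 \<le> K"
    using one_finite by (cases "\<rho> (\<lambda>_. 1)") auto
  obtain c where c: "0 < c" "F (ennreal c) \<le> ennreal (1 / (K + 1))"
    using Young_small[OF F, of "1 / (K + 1)"] K by auto
  define l where "l = (n + 1) / c"
  have l: "0 < l" using c by (simp add: l_def)
  have "of_nat n / ennreal l \<le> ennreal c"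
    using c l by (simp add: ennreal_of_nat_eq_real_of_nat divide_ennreal l_def field_simps)
  then have "F (of_nat n / ennreal l) \<le> ennreal (1 / (K + 1))"
    using c Young_mono[OF F] order_trans by blast
  then have "\<rho> (\<lambda>_. F (of_nat n / ennreal l)) \<le> \<rho> (\<lambda>_. ennreal (1 / (K + 1)) * 1)"
    by (intro mono) auto
  also have "\<dots> = ennreal (1 / (K + 1)) * ennreal K"
    using K by (subst homogeneous) auto
  also have "\<dots> \<le> 1"
    using K by (simp add: ennreal_le_1 flip: ennreal_mult)
  finally show ?thesis
    using l unfolding Orlicz_compose_finite by blast
qed

text \<open>
  If \<open>l\<close> is an admissible scale for both \<open>u\<close> and \<open>v\<close>, then \<open>2 l\<close> is one for \<open>u + v\<close>, since
  \<open>(u + v)/(2 l)\<close> is the midpoint of \<open>u/l\<close> and \<open>v/l\<close>.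
\<close>

lemma (in ri_norm) Orlicz_compose_add_finite:
  assumes F: "Young_function F"
    and [measurable]: "u \<in> borel_measurable M01" "v \<in> borel_measurable M01" "w \<in> borel_measurable M01"
    and le: "\<And>x. w x \<le> u x + v x"
    and "Orlicz_compose F \<rho> u < \<infinity>" "Orlicz_compose F \<rho> v < \<infinity>"
  shows "Orlicz_compose F \<rho> w < \<infinity>"
proof -
  obtain a b where a: "0 < a" "\<rho> (\<lambda>x. F (u x / ennreal a)) \<le> 1"
    and b: "0 < b" "\<rho> (\<lambda>x. F (v x / ennreal b)) \<le> 1"
    using assms unfolding Orlicz_compose_finite by blast
  define l where "l = max a b"
  have l: "0 < l" "a \<le> l" "b \<le> l" using a by (auto simp: l_def)
  note [measurable] = Young_divide_measurable[OF F]
  have pt: "F (w x / ennreal (l * 2))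
      \<le> ennreal (1/2) * F (u x / ennreal a) + ennreal (1/2) * F (v x / ennreal b)" for x
  proof -
    have "w x / ennreal (l * 2) \<le> (u x + v x) / ennreal (l * 2)"
      by (intro divide_right_mono_ennreal le)
    also have "\<dots> = ennreal (1/2) * (u x / ennreal l) + ennreal (1/2) * (v x / ennreal l)"
      using l by (simp add: add_divide_distrib_ennreal divide_ennreal_mult)
    finally have "F (w x / ennreal (l * 2))
        \<le> F (ennreal (1/2) * (u x / ennreal l) + ennreal (1/2) * (v x / ennreal l))"
      by (rule Young_mono[OF F])
    also have "\<dots> \<le> ennreal (1/2) * F (u x / ennreal l) + ennreal (1/2) * F (v x / ennreal l)"
      by (intro Young_convex[OF F]) auto
    also have "\<dots> \<le> ennreal (1/2) * F (u x / ennreal a) + ennreal (1/2) * F (v x / ennreal b)"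
      using l a b by (intro add_mono mult_left_mono Young_divide_antimono[OF F]) auto
    finally show ?thesis .
  qed
  have "\<rho> (\<lambda>x. F (w x / ennreal (l * 2)))
      \<le> \<rho> (\<lambda>x. ennreal (1/2) * F (u x / ennreal a) + ennreal (1/2) * F (v x / ennreal b))"
    by (intro mono pt) measurable
  also have "\<dots> \<le> \<rho> (\<lambda>x. ennreal (1/2) * F (u x / ennreal a))
      + \<rho> (\<lambda>x. ennreal (1/2) * F (v x / ennreal b))"
    by (intro triangle) measurable
  also have "\<dots> = ennreal (1/2) * \<rho> (\<lambda>x. F (u x / ennreal a))
      + ennreal (1/2) * \<rho> (\<lambda>x. F (v x / ennreal b))"
    by (subst (1 2) homogeneous) auto
  also have "\<dots> \<le> ennreal (1/2) * 1 + ennreal (1/2) * 1"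
    by (intro add_mono mult_left_mono a b) auto
  also have "\<dots> = 1"
    using ennreal_plus[of "1/2" "1/2"] by (simp only: mult_1_right) simp
  finally show ?thesis
    using l unfolding Orlicz_compose_finite by (intro exI[of _ "l * 2"]) auto
qed

section \<open>Embeddings of Orlicz spaces\<close>

lemma embedded_imp_subset: "embedded \<sigma> \<tau> \<Longrightarrow> fspace \<sigma> \<subseteq> fspace \<tau>"
  unfolding embedded_def fspace_def
  by (auto simp: ennreal_mult_less_top intro: le_less_trans)

text \<open>
  The next two lemmas replace the limit of suprema by estimates that hold eventually, uniformly over
  the unit ball; the second one also passes from \<^typ>\<open>ereal\<close>-valued to non-negative functions.
\<close>

lemma almost_compactly_embeddedI:
  assumes "\<And>E e. (\<And>n. E n \<in> sets M01) \<Longrightarrow> AE x in M01. (\<lambda>n. indicator (E n) x :: real) \<longlonglongrightarrow> 0 \<Longrightarrow>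
      0 < e \<Longrightarrow> \<forall>\<^sub>F n in sequentially. \<forall>f\<in>fspace \<sigma>. fnorm \<sigma> f \<le> 1 \<longrightarrow>
        fnorm \<tau> (\<lambda>x. f x * indicator (E n) x) \<le> ennreal e"
  shows "almost_compactly_embedded \<sigma> \<tau>"
  unfolding almost_compactly_embedded_def
proof (intro allI impI)
  fix E :: "nat \<Rightarrow> real set"
  assume E: "(\<forall>n. E n \<in> sets M01) \<and> (AE x in M01. (\<lambda>n. indicator (E n) x :: real) \<longlonglongrightarrow> 0)"
  let ?S = "\<lambda>n. SUP f\<in>{f \<in> fspace \<sigma>. fnorm \<sigma> f \<le> 1}. fnorm \<tau> (\<lambda>x. f x * indicator (E n) x)"
  show "?S \<longlonglongrightarrow> 0"
  proof (rule order_tendstoI)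
    fix a :: ennreal assume "0 < a"
    then obtain b where b: "0 < b" "b < a" using dense by blast
    then obtain e where e: "b = ennreal e" "0 < e"
      by (cases b) auto
    have "\<forall>\<^sub>F n in sequentially. \<forall>f\<in>fspace \<sigma>. fnorm \<sigma> f \<le> 1 \<longrightarrow>
        fnorm \<tau> (\<lambda>x. f x * indicator (E n) x) \<le> ennreal e"
      using E e by (intro assms) auto
    then show "\<forall>\<^sub>F n in sequentially. ?S n < a"
    proof eventually_elim
      case (elim n)
      then have "?S n \<le> b" unfolding e by (intro SUP_least) auto
      then show ?case using b by simp
    qed
  qed simp
qed

lemma almost_compactly_embeddedD:
  assumes "almost_compactly_embedded \<sigma> \<tau>"
    and "\<And>n. E n \<in> sets M01" "AE x in M01. (\<lambda>n. indicator (E n) x :: real) \<longlonglongrightarrow> 0" "0 < e"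
  shows "\<forall>\<^sub>F n in sequentially. \<forall>h\<in>borel_measurable M01. \<sigma> h \<le> 1 \<longrightarrow>
        \<tau> (\<lambda>x. h x * indicator (E n) x) \<le> ennreal e"
proof -
  let ?S = "\<lambda>n. SUP f\<in>{f \<in> fspace \<sigma>. fnorm \<sigma> f \<le> 1}. fnorm \<tau> (\<lambda>x. f x * indicator (E n) x)"
  have "?S \<longlonglongrightarrow> 0"
    using assms unfolding almost_compactly_embedded_def by blast
  then have "\<forall>\<^sub>F n in sequentially. ?S n < ennreal e"
    using assms(4) by (intro order_tendstoD) auto
  then show ?thesis
  proof eventually_elim
    case (elim n)
    show ?case
    proof (intro ballI impI)
      fix h assume [measurable]: "h \<in> borel_measurable M01" and h: "\<sigma> h \<le> 1"
      have "(\<lambda>x. enn2ereal (h x)) \<in> {f \<in> fspace \<sigma>. fnorm \<sigma> f \<le> 1}"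
        using h by (auto simp: fspace_iff intro: le_less_trans)
      then have "fnorm \<tau> (\<lambda>x. enn2ereal (h x) * indicator (E n) x) \<le> ?S n"
        by (rule SUP_upper)
      then show "\<tau> (\<lambda>x. h x * indicator (E n) x) \<le> ennreal e"
        using elim by (simp add: fnorm_indicator)
    qed
  qed
qed

text \<open>
  If \<open>l\<close> is an admissible scale for \<open>g\<close> in the Orlicz space of \<open>A \<circ> F\<close>, then \<open>F(g/l)\<close> is in the unit ball of
  \<open>L\<^sup>A\<close>, hence \<open>\<rho>(F(g/l)) \<le> C\<close>.  With \<open>C \<ge> 1\<close> this gives \<open>\<rho>(F(g/(l C))) \<le> 1\<close>, so the same
  constant works for the new embedding.
\<close>

lemma (in ri_norm) embedded_compose:
  assumes A: "Young_function A" and F: "Young_function F" and emb: "embedded (Orlicz A) \<rho>"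
  shows "embedded (Orlicz (A \<circ> F)) (Orlicz_compose F \<rho>)"
proof -
  obtain C0 where C0: "0 < C0" "\<And>f. f \<in> fspace (Orlicz A) \<Longrightarrow> fnorm \<rho> f \<le> ennreal C0 * fnorm (Orlicz A) f"
    using emb unfolding embedded_def by blast
  define C where "C = max 1 C0"
  have C: "1 \<le> C" "C0 \<le> C" by (auto simp: C_def)
  have "fnorm (Orlicz_compose F \<rho>) f \<le> ennreal C * fnorm (Orlicz (A \<circ> F)) f"
    if f: "f \<in> fspace (Orlicz (A \<circ> F))" for f
  proof -
    have [measurable]: "f \<in> borel_measurable M01" using f by (simp add: fspace_iff)
    define g where "g = (\<lambda>x. e2ennreal \<bar>f x\<bar>)"
    have [measurable]: "g \<in> borel_measurable M01" unfolding g_def by measurable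
    note [measurable] = Young_divide_measurable[OF F]
    have *: "Orlicz_compose F \<rho> g \<le> ennreal C * ennreal l"
      if l: "0 < l" and I: "(\<integral>\<^sup>+x. (A \<circ> F) (g x / ennreal l) \<partial>M01) \<le> 1" for l
    proof -
      define h where "h = (\<lambda>x. F (g x / ennreal l))"
      have [measurable]: "h \<in> borel_measurable M01" unfolding h_def by measurable
      have h1: "Orlicz A h \<le> 1"
        using I by (intro Orlicz_unit_ball) (simp add: h_def)
      then have "(\<lambda>x. enn2ereal (h x)) \<in> fspace (Orlicz A)"
        by (auto simp: fspace_iff intro: le_less_trans)
      then have "\<rho> h \<le> ennreal C0 * Orlicz A h"
        using C0(2) by fastforce
      also have "\<dots> \<le> ennreal C * 1"
        using h1 C by (intro mult_mono) (auto simp: ennreal_leI)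
      finally have hC: "\<rho> h \<le> ennreal C" by simp
      have "\<rho> (\<lambda>x. F (g x / ennreal (l * C))) \<le> \<rho> (\<lambda>x. ennreal (1 / C) * h x)"
        using Young_divide[OF F l C(1)] by (intro mono) (auto simp: h_def)
      also have "\<dots> = ennreal (1 / C) * \<rho> h"
        using C by (intro homogeneous) auto
      also have "\<dots> \<le> ennreal (1 / C) * ennreal C"
        by (intro mult_left_mono hC) auto
      also have "\<dots> = 1" using C by (simp flip: ennreal_mult)
      finally have "Orlicz_compose F \<rho> g \<le> ennreal (l * C)"
        using l C by (intro Orlicz_compose_le) auto
      then show ?thesis using l C by (simp add: ennreal_mult mult.commute)
    qed
    have "Orlicz_compose F \<rho> g / ennreal C \<le> Orlicz (A \<circ> F) g"
      unfolding Orlicz_def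
    proof (rule Inf_greatest)
      fix y assume "y \<in> {ennreal l |l. 0 < l \<and> (\<integral>\<^sup>+x. (A \<circ> F) (g x / ennreal l) \<partial>M01) \<le> 1}"
      then obtain l where y: "y = ennreal l" "0 < l" "(\<integral>\<^sup>+x. (A \<circ> F) (g x / ennreal l) \<partial>M01) \<le> 1"
        by blast
      have "Orlicz_compose F \<rho> g / ennreal C \<le> (ennreal C * ennreal l) / ennreal C"
        by (intro divide_right_mono_ennreal * y)
      also have "\<dots> = y"
        using C y by (simp add: divide_ennreal flip: ennreal_mult)
      finally show "Orlicz_compose F \<rho> g / ennreal C \<le> y" .
    qed
    then have "ennreal C * (Orlicz_compose F \<rho> g / ennreal C) \<le> ennreal C * Orlicz (A \<circ> F) g"
      by (intro mult_left_mono) auto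
    moreover have "ennreal C * (Orlicz_compose F \<rho> g / ennreal C) = Orlicz_compose F \<rho> g"
      using C by (subst ennreal_times_divide, subst mult.commute, intro ennreal_mult_divide_eq) auto
    ultimately show ?thesis by (simp add: fnorm_def g_def)
  qed
  then show ?thesis
    unfolding embedded_def using C by (intro exI[of _ C]) auto
qed

text \<open>
  For \<open>g\<close> in the unit ball of the Orlicz space of \<open>A \<circ> F\<close> the function \<open>h = F(g/2)\<close> is in the unit
  ball of \<open>L\<^sup>A\<close>; the \<open>2\<close> is there because the infimum defining the norm need not be attained.
  Choosing \<open>2 ^ k \<ge> 2/\<epsilon>\<close>, the iterated \<open>\<Delta>\<^sub>2\<close> condition bounds \<open>F(g/\<epsilon>)\<close> by
  \<open>C ^ k h + K\<close>, and both terms are small in \<open>X\<close> on the sets \<open>E\<^sub>n\<close>.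
\<close>

lemma (in ri_norm) almost_compactly_embedded_compose:
  assumes A: "Young_function A" and F: "Young_function F" and D2: "Delta2_near_infinity F"
    and emb: "almost_compactly_embedded (Orlicz A) \<rho>"
  shows "almost_compactly_embedded (Orlicz (A \<circ> F)) (Orlicz_compose F \<rho>)"
proof (rule almost_compactly_embeddedI)
  fix E :: "nat \<Rightarrow> real set" and e :: real
  assume E[measurable]: "\<And>n. E n \<in> sets M01"
    and E0: "AE x in M01. (\<lambda>n. indicator (E n) x :: real) \<longlonglongrightarrow> 0" and e: "0 < e"
  note [measurable] = Young_divide_measurable[OF F]
  obtain C t0 where C: "0 < C"
    and D: "\<And>k t. F (2 ^ k * t) \<le> ennreal (C ^ k) * F t + F (2 ^ k * ennreal t0)"
    using Delta2_iterate[OF F D2] by metis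
  obtain k where k: "2 / e < 2 ^ k"
    using real_arch_pow[of 2 "2 / e"] by auto
  have "2 ^ k * ennreal t0 < \<infinity>"
    by (simp add: ennreal_mult_less_top power_less_top_ennreal)
  then have "F (2 ^ k * ennreal t0) < \<infinity>"
    using D2 unfolding Delta2_near_infinity_def by blast
  then obtain K where K: "F (2 ^ k * ennreal t0) = ennreal K" "0 \<le> K"
    by (cases "F (2 ^ k * ennreal t0)") auto
  obtain c where c: "0 < c" "A (ennreal c) \<le> ennreal 1"
    using Young_small[OF A, of 1] by auto
  \<comment> \<open>\<open>d\<close> is to bound both \<open>\<rho>(h \<chi>)\<close> and \<open>\<rho>(c \<chi>)\<close>; as \<open>K \<chi> = (K/c) (c \<chi>)\<close>, the total is then
    at most \<open>(C ^ k + K/c) d = 1\<close>.\<close>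
  define d where "d = 1 / (C ^ k + K / c)"
  have pos: "0 < C ^ k + K / c" using C K c by (simp add: add_pos_nonneg)
  then have d: "0 < d" by (simp add: d_def)
  have cA: "Orlicz A (\<lambda>_. ennreal c) \<le> 1"
  proof (rule Orlicz_unit_ball)
    have "emeasure M01 (space M01) = 1"
      by (simp add: space_restrict_space emeasure_restrict_space)
    then show "(\<integral>\<^sup>+x. A (ennreal c) \<partial>M01) \<le> 1" using c by simp
  qed
  show "\<forall>\<^sub>F n in sequentially. \<forall>f\<in>fspace (Orlicz (A \<circ> F)). fnorm (Orlicz (A \<circ> F)) f \<le> 1 \<longrightarrow>
      fnorm (Orlicz_compose F \<rho>) (\<lambda>x. f x * indicator (E n) x) \<le> ennreal e"
    using almost_compactly_embeddedD[OF emb E E0 d]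
  proof eventually_elim
    case (elim n)
    show ?case
    proof (intro ballI impI)
      fix f assume f: "f \<in> fspace (Orlicz (A \<circ> F))" "fnorm (Orlicz (A \<circ> F)) f \<le> 1"
      have [measurable]: "f \<in> borel_measurable M01" using f by (simp add: fspace_iff)
      define g where "g = (\<lambda>x. e2ennreal \<bar>f x\<bar>)"
      have [measurable]: "g \<in> borel_measurable M01" unfolding g_def by measurable
      define h where "h = (\<lambda>x. F (g x / ennreal 2))"
      have [measurable]: "h \<in> borel_measurable M01" unfolding h_def by measurable
      have "Orlicz (A \<circ> F) g < 2"
        using f(2) by (auto simp: fnorm_def g_def intro: le_less_trans)
      then obtain l where l: "0 < l" "ennreal l < 2" "(\<integral>\<^sup>+x. (A \<circ> F) (g x / ennreal l) \<partial>M01) \<le> 1"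
        unfolding Orlicz_eq by (rule Orlicz_compose_less)
      have "l \<le> 2"
        using l(1,2) by (metis ennreal_le_iff ennreal_numeral less_imp_le zero_le_numeral)
      then have "(\<integral>\<^sup>+x. (A \<circ> F) (g x / ennreal 2) \<partial>M01) \<le> 1"
        by (intro order_trans[OF nn_integral_mono l(3)] Young_divide_antimono Young_compose A F l(1))
      then have "Orlicz A h \<le> 1"
        by (intro Orlicz_unit_ball) (simp add: h_def)
      then have hd: "\<rho> (\<lambda>x. h x * indicator (E n) x) \<le> ennreal d"
        using elim by auto
      have cd: "\<rho> (\<lambda>x. ennreal c * indicator (E n) x) \<le> ennreal d"
        using elim cA by auto
      have pt: "F (g x * indicator (E n) x / ennreal e)
          \<le> ennreal (C ^ k) * (h x * indicator (E n) x)
            + ennreal (K / c) * (ennreal c * indicator (E n) x)" for x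
      proof (cases "x \<in> E n")
        case True
        have "g x / ennreal e \<le> 2 ^ k * (g x / ennreal 2)"
        proof -
          have "g x / ennreal e = ennreal (2 / e) * (g x / ennreal 2)"
            using divide_ennreal_mult[of 2 "e / 2" "g x"] e by simp
          also have "\<dots> \<le> ennreal (2 ^ k) * (g x / ennreal 2)"
            using k by (intro mult_right_mono) (auto simp: ennreal_leI)
          also have "ennreal (2 ^ k) = 2 ^ k"
            by (simp flip: ennreal_power)
          finally show ?thesis .
        qed
        then have "F (g x / ennreal e) \<le> F (2 ^ k * (g x / ennreal 2))"
          by (rule Young_mono[OF F])
        also have "\<dots> \<le> ennreal (C ^ k) * h x + ennreal K"
          using D[of k "g x / ennreal 2"] K by (simp add: h_def)
        also have "ennreal K = ennreal (K / c) * ennreal c"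
          using K c by (simp flip: ennreal_mult)
        finally show ?thesis using True by simp
      next
        case False
        then show ?thesis using F by (simp add: Young_zero)
      qed
      have "\<rho> (\<lambda>x. F (g x * indicator (E n) x / ennreal e))
          \<le> \<rho> (\<lambda>x. ennreal (C ^ k) * (h x * indicator (E n) x)
            + ennreal (K / c) * (ennreal c * indicator (E n) x))"
        by (intro mono pt) measurable
      also have "\<dots> \<le> \<rho> (\<lambda>x. ennreal (C ^ k) * (h x * indicator (E n) x))
            + \<rho> (\<lambda>x. ennreal (K / c) * (ennreal c * indicator (E n) x))"
        by (intro triangle) measurable
      also have "\<dots> = ennreal (C ^ k) * \<rho> (\<lambda>x. h x * indicator (E n) x)
            + ennreal (K / c) * \<rho> (\<lambda>x. ennreal c * indicator (E n) x)"
        using C K c by (subst (1 2) homogeneous) auto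
      also have "\<dots> \<le> ennreal (C ^ k) * ennreal d + ennreal (K / c) * ennreal d"
        by (intro add_mono mult_left_mono hd cd) auto
      also have "\<dots> = ennreal ((C ^ k + K / c) * d)"
        using C K c d by (simp add: distrib_right flip: ennreal_mult ennreal_plus)
      also have "\<dots> = 1"
        using pos by (simp add: d_def)
      finally have "Orlicz_compose F \<rho> (\<lambda>x. g x * indicator (E n) x) \<le> ennreal e"
        using e by (intro Orlicz_compose_le)
      then show "fnorm (Orlicz_compose F \<rho>) (\<lambda>x. f x * indicator (E n) x) \<le> ennreal e"
        by (simp add: fnorm_indicator g_def)
    qed
  qed
qed

text \<open>A Young function is \<open>\<infinity>\<close> at \<open>\<infinity>\<close>, so the modular would be infinite otherwise.\<close>

lemma Orlicz_finite_AE: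
  assumes B: "Young_function B" and [measurable]: "g \<in> borel_measurable M01" and "Orlicz B g < \<infinity>"
  shows "AE x in M01. g x < \<infinity>"
proof -
  obtain l where l: "0 < l" "(\<integral>\<^sup>+x. B (g x / ennreal l) \<partial>M01) \<le> 1"
    using assms unfolding Orlicz_eq Orlicz_compose_finite by blast
  note [measurable] = Young_divide_measurable[OF B]
  have "AE x in M01. B (g x / ennreal l) \<noteq> \<infinity>"
    using l by (intro nn_integral_PInf_AE) (auto simp: top_unique)
  then show ?thesis
  proof eventually_elim
    case (elim x)
    show ?case
    proof (rule ccontr)
      assume "\<not> g x < \<infinity>"
      then have "g x / ennreal l = \<infinity>"
        by (simp add: less_top[symmetric] ennreal_top_divide)
      then show False using elim Young_top[OF B] by simp
    qed
  qed
qed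

text \<open>
  After scaling \<open>f\<close> into the unit ball, \<open>|f|\<close> is at most \<open>|f| \<chi>\<^bsub>E n\<^esub> + n\<close> with
  \<open>E\<^sub>n = {|f| > n}\<close>.  Almost-compactness applies to these sets because \<open>f\<close> is finite a.e., and it
  controls the first summand for one large \<open>n\<close>; the second is a constant.
\<close>

lemma (in ri_norm) almost_compactly_embedded_imp_subset:
  assumes B: "Young_function B" and F: "Young_function F"
    and emb: "almost_compactly_embedded (Orlicz B) (Orlicz_compose F \<rho>)"
  shows "fspace (Orlicz B) \<subseteq> fspace (Orlicz_compose F \<rho>)"
proof
  fix f assume f: "f \<in> fspace (Orlicz B)"
  have [measurable]: "f \<in> borel_measurable M01" using f by (simp add: fspace_iff)
  define g where "g = (\<lambda>x. e2ennreal \<bar>f x\<bar>)"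
  have gm[measurable]: "g \<in> borel_measurable M01" unfolding g_def by measurable
  have gB: "Orlicz B g < \<infinity>" using f by (simp add: fspace_iff fnorm_def g_def)
  then obtain l where l: "0 < l" "(\<integral>\<^sup>+x. B (g x / ennreal l) \<partial>M01) \<le> 1"
    unfolding Orlicz_eq Orlicz_compose_finite by blast
  define h where "h = (\<lambda>x. g x / ennreal l)"
  have hm[measurable]: "h \<in> borel_measurable M01" unfolding h_def by measurable
  have h1: "Orlicz B h \<le> 1"
    using l by (intro Orlicz_unit_ball) (simp add: h_def)
  define E where "E = (\<lambda>n::nat. {x \<in> space M01. of_nat n < h x})"
  have Em[measurable]: "E n \<in> sets M01" for n unfolding E_def by measurable
  have "AE x in M01. h x < \<infinity>"
    using h1 by (intro Orlicz_finite_AE[OF B hm]) (auto intro: le_less_trans)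
  then have "AE x in M01. (\<lambda>n. indicator (E n) x :: real) \<longlonglongrightarrow> 0"
  proof eventually_elim
    case (elim x)
    then obtain r where r: "h x = ennreal r" "0 \<le> r" by (cases "h x") auto
    obtain N where N: "r \<le> real N" using real_arch_simple by blast
    have "h x \<le> of_nat n" if "N \<le> n" for n
      using r N that by (simp add: ennreal_of_nat_eq_real_of_nat)
    then have "\<forall>\<^sub>F n in sequentially. indicator (E n) x = (0::real)"
      unfolding eventually_sequentially E_def by (intro exI[of _ N]) (auto simp: indicator_def not_less)
    then show ?case by (rule tendsto_eventually)
  qed
  from almost_compactly_embeddedD[OF emb Em this, of 1]
  obtain n where "\<forall>h\<in>borel_measurable M01. Orlicz B h \<le> 1 \<longrightarrow>
      Orlicz_compose F \<rho> (\<lambda>x. h x * indicator (E n) x) \<le> ennreal 1"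
    by (auto dest!: eventually_happens)
  then have "Orlicz_compose F \<rho> (\<lambda>x. h x * indicator (E n) x) \<le> 1"
    using h1 by simp
  then have u: "Orlicz_compose F \<rho> (\<lambda>x. h x * indicator (E n) x) < \<infinity>"
    by (auto intro: le_less_trans)
  \<comment> \<open>Outside \<open>(0,1)\<close>, where \<open>h\<close> is arbitrary and \<open>E n\<close> is empty, \<open>h \<le> h \<chi> + n\<close> may fail.\<close>
  define h' where "h' = (\<lambda>x. h x * indicator (space M01) x)"
  have [measurable]: "h' \<in> borel_measurable M01" unfolding h'_def by measurable
  have "Orlicz_compose F \<rho> h' < \<infinity>"
  proof (rule Orlicz_compose_add_finite[OF F _ _ _ _ u Orlicz_compose_const_finite[OF F, of n]])
    show "h' x \<le> h x * indicator (E n) x + of_nat n" for x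
      by (auto simp: h'_def E_def indicator_def not_less)
  qed measurable
  then obtain m where m: "0 < m" "\<rho> (\<lambda>x. F (h' x / ennreal m)) \<le> 1"
    unfolding Orlicz_compose_finite by blast
  note [measurable] = Young_divide_measurable[OF F]
  have "\<rho> (\<lambda>x. F (g x / ennreal (l * m))) \<le> \<rho> (\<lambda>x. F (h' x / ennreal m))"
  proof (intro mono)
    fix x assume "x \<in> space M01"
    have "g x / ennreal (l * m) = ennreal (1 / m) * (g x / ennreal l)"
      by (rule divide_ennreal_mult[OF l(1) m(1)])
    also have "\<dots> = h' x / ennreal m"
      using m \<open>x \<in> space M01\<close>
      by (simp add: h_def h'_def divide_ennreal_def inverse_ennreal divide_inverse mult.commute)
    finally show "F (g x / ennreal (l * m)) \<le> F (h' x / ennreal m)" by simp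
  qed measurable
  then have "Orlicz_compose F \<rho> g < \<infinity>"
    using l m unfolding Orlicz_compose_finite by (intro exI[of _ "l * m"]) auto
  then show "f \<in> fspace (Orlicz_compose F \<rho>)"
    by (simp add: fspace_iff fnorm_def g_def)
qed

text \<open>
  The function \<open>k = F(|f|/l)\<close> carries the whole information on \<open>f\<close>: any Orlicz space that contains
  \<open>k\<close> yields one that contains \<open>f\<close>.
\<close>

lemma (in ri_norm) mem_Orlicz_composeE:
  assumes F: "Young_function F" and f: "f \<in> fspace (Orlicz_compose F \<rho>)"
  obtains k where "k \<in> fspace \<rho>"
    "\<And>A. Young_function A \<Longrightarrow> k \<in> fspace (Orlicz A) \<Longrightarrow> f \<in> fspace (Orlicz (A \<circ> F))"
proof -
  have [measurable]: "f \<in> borel_measurable M01" using f by (simp add: fspace_iff)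
  define g where "g = (\<lambda>x. e2ennreal \<bar>f x\<bar>)"
  have gm[measurable]: "g \<in> borel_measurable M01" unfolding g_def by measurable
  note [measurable] = Young_divide_measurable[OF F]
  have "Orlicz_compose F \<rho> g < \<infinity>" using f by (simp add: fspace_iff fnorm_def g_def)
  then obtain l where l: "0 < l" "\<rho> (\<lambda>x. F (g x / ennreal l)) \<le> 1"
    unfolding Orlicz_compose_finite by blast
  show ?thesis
  proof
    show "(\<lambda>x. enn2ereal (F (g x / ennreal l))) \<in> fspace \<rho>"
      using l(2) by (auto simp: fspace_iff intro: le_less_trans)
    fix A assume A: "Young_function A"
      and k: "(\<lambda>x. enn2ereal (F (g x / ennreal l))) \<in> fspace (Orlicz A)"
    have "Orlicz (A \<circ> F) g < \<infinity>"
      using k by (intro Orlicz_compose_mem[OF A F l(1)]) (simp add: fspace_iff)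
    then show "f \<in> fspace (Orlicz (A \<circ> F))"
      by (simp add: fspace_iff fnorm_def g_def)
  qed
qed

theorem theoremA12:
  fixes \<rho> :: "(real \<Rightarrow> ennreal) \<Rightarrow> ennreal" and F :: "ennreal \<Rightarrow> ennreal"
  assumes "ri_norm \<rho>"
    and "Young_function F"
  shows "(sub_diagonal \<rho> \<longrightarrow> sub_diagonal (Orlicz_compose F \<rho>)) \<and>
    (uniformly_sub_diagonal \<rho> \<and> Delta2_near_infinity F \<longrightarrow>
      uniformly_sub_diagonal (Orlicz_compose F \<rho>))"
proof (intro conjI impI)
  interpret ri_norm \<rho> by fact
  note F = \<open>Young_function F\<close>
  let ?Y = "Orlicz_compose F \<rho>"
  assume "sub_diagonal \<rho>"
  then have X: "fspace \<rho> = \<Union> {fspace (Orlicz A) | A. Young_function A \<and> embedded (Orlicz A) \<rho>}"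
    by (simp add: sub_diagonal_def)
  show "sub_diagonal ?Y"
    unfolding sub_diagonal_def
  proof (intro equalityI subsetI)
    fix f assume "f \<in> fspace ?Y"
    then obtain k where k: "k \<in> fspace \<rho>"
      "\<And>A. Young_function A \<Longrightarrow> k \<in> fspace (Orlicz A) \<Longrightarrow> f \<in> fspace (Orlicz (A \<circ> F))"
      using mem_Orlicz_composeE[OF F] by metis
    from k(1) obtain A where A: "Young_function A" "embedded (Orlicz A) \<rho>" "k \<in> fspace (Orlicz A)"
      unfolding X by blast
    then show "f \<in> \<Union> {fspace (Orlicz B) | B. Young_function B \<and> embedded (Orlicz B) ?Y}"
      using k(2) Young_compose[OF A(1) F] embedded_compose[OF A(1) F A(2)] by blast
  qed (use embedded_imp_subset in blast)
next
  interpret ri_norm \<rho> by fact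
  note F = \<open>Young_function F\<close>
  let ?Y = "Orlicz_compose F \<rho>"
  assume "uniformly_sub_diagonal \<rho> \<and> Delta2_near_infinity F"
  then have D2: "Delta2_near_infinity F" and X: "fspace \<rho> =
      \<Union> {fspace (Orlicz A) | A. Young_function A \<and> almost_compactly_embedded (Orlicz A) \<rho>}"
    by (simp_all add: uniformly_sub_diagonal_def)
  show "uniformly_sub_diagonal ?Y"
    unfolding uniformly_sub_diagonal_def
  proof (intro equalityI subsetI)
    fix f assume "f \<in> fspace ?Y"
    then obtain k where k: "k \<in> fspace \<rho>"
      "\<And>A. Young_function A \<Longrightarrow> k \<in> fspace (Orlicz A) \<Longrightarrow> f \<in> fspace (Orlicz (A \<circ> F))"
      using mem_Orlicz_composeE[OF F] by metis
    from k(1) obtain A where A: "Young_function A" "almost_compactly_embedded (Orlicz A) \<rho>"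
      "k \<in> fspace (Orlicz A)"
      unfolding X by blast
    then show "f \<in> \<Union> {fspace (Orlicz B) | B. Young_function B \<and> almost_compactly_embedded (Orlicz B) ?Y}"
      using k(2) Young_compose[OF A(1) F] almost_compactly_embedded_compose[OF A(1) F D2 A(2)] by blast
  qed (use almost_compactly_embedded_imp_subset[OF _ F] in blast)
qed

end
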